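(* Let $D$ be a minimal strong digraph and let $C_q$ be a directed cycle of length $q\ge 2$ contained in $D$. Then the number of linear vertices of $D$ is at least $\left\lfloor \frac{q+1}{2}\right\rfloor$.
   Context: An arc $uv$ of a digraph is transitive if there is another directed $uv$-path not using the arc $uv$. A minimal strong digraph is a strongly connected digraph with no transitive arcs. A vertex $v$ of $D$ is linear if its indegree and outdegree in $D$ are both equal to $1$. *)

theory Defs
  imports "Graph_Theory.Graph_Theory"
begin

context pre_digraph
begin

definition transitive_arc :: "'b \<Rightarrow> bool" where
  "transitive_arc e \<longleftrightarrow> e \<in> arcs G \<and> (\<exists>p. apath (tail G e) p (head G e) \<and> e \<notin> set p)"

definition linear_vertex :: "'a \<Rightarrow> bool" where
  "linear_vertex v \<longleftrightarrow> v \<in> verts G \<and> in_degree G v = 1 \<and> out_degree G v = 1"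

end

text \<open>As usual for minimal strong digraphs, digraphs are finite and have neither loops nor
  parallel arcs, which is what the locale \<^locale>\<open>digraph\<close> states.\<close>

locale minimal_strong_digraph = digraph +
  assumes strongly_connected: "strongly_connected G"
    and no_transitive_arcs: "\<And>e. \<not> transitive_arc e"

end

theory Submission
  imports Defs
begin

text \<open>For a vertex set \<open>H\<close> inducing a strong subdigraph with \<open>e(H)\<close> arcs,
  the sum of the degrees over \<open>H\<close> is at most \<open>2 e(H)\<close> plus twice the number of linear
  vertices outside \<open>H\<close>. This is an equality for \<open>H = V\<close>, and one descends to smaller \<open>H\<close> by
  undoing the attachment of ears. An ear with \<open>r\<close> inner vertices brings exactly \<open>r + 1\<close> new arcs,
  since any other new arc would be transitive; so it suffices that the inner vertices \<open>v\<close> satisfy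
  \<open>\<Sum>(deg v + 2 [v linear]) \<ge> 2 r + 2\<close>. Each term is at least \<open>3\<close>, which settles \<open>r \<ge> 2\<close>.
  For \<open>r = 1\<close> the term is at least \<open>4\<close>, because indegree \<open>1\<close> forces outdegree \<open>1\<close> and conversely:
  a second way out of \<open>v\<close> would lead back to \<open>H\<close> and make the last arc of the ear transitive.

  A cycle of length \<open>q\<close> induces exactly \<open>q\<close> arcs, and \<open>deg v + [v linear] \<ge> 3\<close> on it. Hence the
  number of linear vertices on the cycle plus twice the number of those off it is at least \<open>q\<close>.\<close>

section \<open>Walks that avoid an arc or enter a set\<close>

text \<open>Follow the walk from \<open>u\<close> to \<open>y\<close> until it is about to enter
  \<open>v\<close>. By \<open>pred\<close> it is then in \<open>H\<close>, and from there
  \<open>y\<close> is reachable inside \<open>H\<close>, hence without \<open>v\<close>.\<close>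

lemma rtrancl_avoiding_arc:
  assumes HS: "\<And>a b. a \<in> H \<Longrightarrow> b \<in> H \<Longrightarrow> (a, b) \<in> (Restr E H)\<^sup>*"
    and pred: "\<And>z. (z, v) \<in> E \<Longrightarrow> z \<in> H"
    and "v \<notin> H" "y \<in> H" "(u, y) \<in> E\<^sup>*" "u \<noteq> v"
  shows "(u, y) \<in> (E - {(v, y)})\<^sup>*"
  using assms(5,6)
proof (induction rule: converse_rtrancl_induct)
  case base
  then show ?case by simp
next
  case (step u w)
  show ?case
  proof (cases "w = v")
    case True
    then have "(u, y) \<in> (Restr E H)\<^sup>*"
      using HS pred step.hyps(1) \<open>y \<in> H\<close> by blast
    moreover have "Restr E H \<subseteq> E - {(v, y)}"
      using \<open>v \<notin> H\<close> by blast
    ultimately show ?thesis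
      by (meson rtrancl_mono subsetD)
  next
    case False
    then show ?thesis
      using step by (blast intro: converse_rtrancl_into_rtrancl)
  qed
qed

text \<open>A walk is cut at its first entry into \<open>H\<close> and its repetitions are
  removed.\<close>

lemma path_to_set:
  assumes "(v, y) \<in> E\<^sup>*" "v \<notin> H" "y \<in> H"
  shows "\<exists>vs z. vs \<noteq> [] \<and> hd vs = v \<and> distinct vs \<and> set vs \<inter> H = {} \<and> z \<in> H
    \<and> successively (\<lambda>a b. (a, b) \<in> E) (vs @ [z])"
  using assms(1,2)
proof (induction rule: converse_rtrancl_induct)
  case base
  then show ?case using \<open>y \<in> H\<close> by simp
next
  case (step v w)
  show ?case
  proof (cases "w \<in> H")
    case True
    then show ?thesis
      using step by (intro exI[of _ "[v]"] exI[of _ w]) auto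
  next
    case False
    then obtain vs z where vs: "vs \<noteq> []" "hd vs = w" "distinct vs" "set vs \<inter> H = {}" "z \<in> H"
      "successively (\<lambda>a b. (a, b) \<in> E) (vs @ [z])"
      using step.IH by blast
    show ?thesis
    proof (cases "v \<in> set vs")
      case True
      \<comment> \<open>The new first vertex occurs on the path already, so only the part from that
        occurrence on is kept.\<close>
      then obtain as bs where ab: "vs = as @ v # bs"
        by (meson split_list)
      then show ?thesis
        using vs by (intro exI[of _ "v # bs"] exI[of _ z]) (auto simp: successively_append_iff)
    next
      case False
      then show ?thesis
        using vs step by (intro exI[of _ "v # vs"] exI[of _ z]) (auto simp: successively_Cons)
    qed
  qed
qed

section \<open>Consecutive pairs of a vertex list\<close>

abbreviation list_arcs :: "'a list \<Rightarrow> ('a \<times> 'a) set" where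
  "list_arcs xs \<equiv> set (zip xs (tl xs))"

lemma list_arcs_subset:
  "successively (\<lambda>a b. (a, b) \<in> E) xs \<Longrightarrow> list_arcs xs \<subseteq> E"
  by (induction xs rule: induct_list012) auto

lemma card_list_arcs: "card (list_arcs xs) \<le> length xs - 1"
  using card_length[of "zip xs (tl xs)"] by simp

lemma successively_list_arcs: "successively (\<lambda>a b. (a, b) \<in> list_arcs xs) xs"
proof (induction xs rule: induct_list012)
  case (3 x y zs)
  then show ?case
    by (auto elim!: successively_mono)
qed auto

lemma successively_rtrancl:
  assumes "successively (\<lambda>a b. (a, b) \<in> R) xs" "v \<in> set xs"
  shows "(hd xs, v) \<in> R\<^sup>*" "(v, last xs) \<in> R\<^sup>*"
proof -
  have hd_last: "(hd ys, last ys) \<in> R\<^sup>*"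
    if "successively (\<lambda>a b. (a, b) \<in> R) ys" "ys \<noteq> []" for ys
    using that by (induction ys rule: induct_list012) (auto intro: converse_rtrancl_into_rtrancl)
  obtain as bs where xs: "xs = (as @ [v]) @ bs"
    using split_list[OF assms(2)] by auto
  then have "successively (\<lambda>a b. (a, b) \<in> R) (as @ [v])"
    using assms(1) by (simp add: xs successively_append_iff)
  from hd_last[OF this] show "(hd xs, v) \<in> R\<^sup>*"
    unfolding xs by (cases as) auto
  have "successively (\<lambda>a b. (a, b) \<in> R) (v # bs)"
    using assms(1) by (simp add: xs successively_append_iff)
  from hd_last[OF this] show "(v, last xs) \<in> R\<^sup>*"
    unfolding xs by auto
qed

section \<open>Minimal strong digraphs as relations\<close>

text \<open>Without parallel arcs, pairs of vertices can stand for arcs. The axiom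
  \<open>no_detour\<close> excludes transitive arcs and also loops, because the empty walk is a
  detour of a loop.\<close>

locale minimal_strong_relation =
  fixes V :: "'a set" and E :: "('a \<times> 'a) set"
  assumes finite_V: "finite V"
    and E_subset: "E \<subseteq> V \<times> V"
    and strong: "\<And>u v. u \<in> V \<Longrightarrow> v \<in> V \<Longrightarrow> (u, v) \<in> E\<^sup>*"
    and no_detour: "\<And>u v. (u, v) \<in> E \<Longrightarrow> (u, v) \<notin> (E - {(u, v)})\<^sup>*"
begin

definition deg :: "'a \<Rightarrow> nat" where
  "deg v = card (E `` {v}) + card (E\<inverse> `` {v})"

definition lin :: "'a \<Rightarrow> bool" where
  "lin v \<longleftrightarrow> card (E `` {v}) = 1 \<and> card (E\<inverse> `` {v}) = 1"

lemma converse: "minimal_strong_relation V (E\<inverse>)"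
proof
  fix u v
  assume "(u, v) \<in> E\<inverse>"
  then have "(v, u) \<notin> (E - {(v, u)})\<^sup>*"
    using no_detour by blast
  moreover have "E\<inverse> - {(u, v)} = (E - {(v, u)})\<inverse>"
    by blast
  ultimately show "(u, v) \<notin> (E\<inverse> - {(u, v)})\<^sup>*"
    by (simp add: rtrancl_converse)
qed (use finite_V E_subset strong in \<open>auto simp: rtrancl_converse\<close>)

lemma finite_E: "finite E"
  using finite_V E_subset finite_subset by blast

lemma finite_neighbours: "finite (E `` {v})" "finite (E\<inverse> `` {v})"
  using finite_E by auto

lemma neighbours_nonempty:
  assumes "v \<in> V" "w \<in> V" "v \<noteq> w"
  shows "E `` {v} \<noteq> {}" "E\<inverse> `` {v} \<noteq> {}"
proof -
  have "(v, w) \<in> E\<^sup>*" "(w, v) \<in> E\<^sup>*"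
    using strong assms by auto
  then show "E `` {v} \<noteq> {}" "E\<inverse> `` {v} \<noteq> {}"
    using assms(3) by (blast elim: converse_rtranclE, blast elim: rtranclE)
qed

text \<open>Both degrees are positive, so their sum is at least 2, and it is 2 only for a linear
  vertex.\<close>

lemma deg_plus_lin:
  assumes "E `` {v} \<noteq> {}" "E\<inverse> `` {v} \<noteq> {}"
  shows "deg v + of_bool (lin v) \<ge> 3"
proof -
  have "card (E `` {v}) \<noteq> 0" "card (E\<inverse> `` {v}) \<noteq> 0"
    using assms finite_neighbours by auto
  then show ?thesis
    unfolding deg_def lin_def by auto
qed

lemma sum_deg_V: "sum deg V = 2 * card E"
proof -
  have "E = Sigma V (\<lambda>v. E `` {v})" "E\<inverse> = Sigma V (\<lambda>v. E\<inverse> `` {v})"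
    using E_subset by auto
  then have "card E = (\<Sum>v\<in>V. card (E `` {v}))" "card (E\<inverse>) = (\<Sum>v\<in>V. card (E\<inverse> `` {v}))"
    using card_SigmaI[OF finite_V] finite_neighbours by metis+
  then show ?thesis
    by (simp add: deg_def sum.distrib)
qed

text \<open>A strongly connected spanning subrelation of an induced subdigraph is all of it:
  any further arc would be transitive.\<close>

lemma Restr_subset_strong:
  assumes "F \<subseteq> E" "\<And>a b. a \<in> H \<Longrightarrow> b \<in> H \<Longrightarrow> (a, b) \<in> F\<^sup>*"
  shows "Restr E H \<subseteq> F"
proof (rule ccontr)
  assume "\<not> Restr E H \<subseteq> F"
  then obtain a b where ab: "(a, b) \<in> E" "a \<in> H" "b \<in> H" "(a, b) \<notin> F"
    by blast
  then have "F \<subseteq> E - {(a, b)}"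
    using assms(1) by blast
  then have "F\<^sup>* \<subseteq> (E - {(a, b)})\<^sup>*"
    by (rule rtrancl_mono)
  then show False
    using assms(2) ab no_detour by blast
qed

text \<open>A second successor \<open>w\<close> would have a walk to \<open>y\<close> avoiding the
  arc from \<open>v\<close> to \<open>y\<close>, as all predecessors of \<open>v\<close> lie in
  \<open>H\<close>. Going through \<open>w\<close> would then be a detour of that arc.\<close>

lemma unique_successor:
  assumes HS: "\<And>a b. a \<in> H \<Longrightarrow> b \<in> H \<Longrightarrow> (a, b) \<in> (Restr E H)\<^sup>*"
    and "E\<inverse> `` {v} \<subseteq> H" "v \<notin> H" "y \<in> H" "(v, y) \<in> E"
  shows "E `` {v} = {y}"
proof (rule ccontr)
  assume "E `` {v} \<noteq> {y}"
  then obtain w where w: "(v, w) \<in> E" "w \<noteq> y"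
    using assms(5) by blast
  have "w \<noteq> v"
    using no_detour w(1) by blast
  moreover have "(w, y) \<in> E\<^sup>*"
    using strong E_subset w(1) assms(5) by blast
  ultimately have "(w, y) \<in> (E - {(v, y)})\<^sup>*"
    using assms by (intro rtrancl_avoiding_arc[where H = H]) auto
  then have "(v, y) \<in> (E - {(v, y)})\<^sup>*"
    using w by (intro converse_rtrancl_into_rtrancl[of v w]) auto
  then show False
    using no_detour assms(5) by blast
qed

lemma unique_predecessor:
  assumes HS: "\<And>a b. a \<in> H \<Longrightarrow> b \<in> H \<Longrightarrow> (a, b) \<in> (Restr E H)\<^sup>*"
    and "E `` {v} \<subseteq> H" "v \<notin> H" "x \<in> H" "(x, v) \<in> E"
  shows "E\<inverse> `` {v} = {x}"
proof -
  interpret conv: minimal_strong_relation V "E\<inverse>"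
    by (rule converse)
  have "Restr (E\<inverse>) H = (Restr E H)\<inverse>"
    by blast
  then have "(a, b) \<in> (Restr (E\<inverse>) H)\<^sup>*" if "a \<in> H" "b \<in> H" for a b
    using HS that by (simp only: rtrancl_converse converse_iff)
  then show ?thesis
    using assms(2-) by (intro conv.unique_successor[where H = H]) auto
qed

section \<open>Ears and the degree inequality\<close>

text \<open>Some arc leaves \<open>H\<close> by strong connectivity; from its head a path is
  followed up to its first return to \<open>H\<close>. The ends \<open>x\<close> and
  \<open>y\<close> may coincide.\<close>

lemma ear_exists:
  assumes "H \<subseteq> V" "H \<noteq> {}" "H \<noteq> V"
  obtains x vs y where "x \<in> H" "y \<in> H" "vs \<noteq> []" "distinct vs" "set vs \<inter> H = {}"
    "successively (\<lambda>a b. (a, b) \<in> E) (x # vs @ [y])"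
proof -
  obtain h w where "h \<in> H" "w \<in> V" "w \<notin> H"
    using assms by blast
  then have "(h, w) \<in> E\<^sup>*"
    using strong assms(1) by blast
  then have "\<exists>x v. x \<in> H \<and> v \<notin> H \<and> (x, v) \<in> E"
    using \<open>h \<in> H\<close> \<open>w \<notin> H\<close> by (induction rule: rtrancl_induct) auto
  then obtain x v where xv: "x \<in> H" "v \<notin> H" "(x, v) \<in> E"
    by blast
  then have "(v, x) \<in> E\<^sup>*"
    using strong E_subset by blast
  from path_to_set[OF this \<open>v \<notin> H\<close> \<open>x \<in> H\<close>] obtain vs y
    where "vs \<noteq> []" "hd vs = v" "distinct vs" "set vs \<inter> H = {}" "y \<in> H"
      "successively (\<lambda>a b. (a, b) \<in> E) (vs @ [y])"
    by blast
  with xv show thesis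
    by (intro that[of x y vs]) (auto simp: successively_Cons)
qed

lemma ear_weight:
  assumes HS: "\<And>a b. a \<in> H \<Longrightarrow> b \<in> H \<Longrightarrow> (a, b) \<in> (Restr E H)\<^sup>*"
    and "x \<in> H" "y \<in> H" "vs \<noteq> []" "distinct vs" "set vs \<subseteq> V - H"
    and succ: "successively (\<lambda>a b. (a, b) \<in> E) (x # vs @ [y])" and "H \<subseteq> V"
  shows "(\<Sum>v\<in>set vs. deg v + 2 * of_bool (lin v)) \<ge> 2 * (length vs + 1)"
proof -
  have ge3: "deg v + of_bool (lin v) \<ge> 3" if "v \<in> set vs" for v
    using that assms by (intro deg_plus_lin neighbours_nonempty[of v x]) auto
  show ?thesis
  proof (cases "length vs = 1")
    case True
    then obtain v where vs: "vs = [v]"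
      by (cases vs) auto
    have v: "v \<notin> H" "(x, v) \<in> E" "(v, y) \<in> E"
      using assms vs by auto
    have "lin v" if "card (E\<inverse> `` {v}) = 1"
    proof -
      \<comment> \<open>The only predecessor lies in \<open>H\<close>, which is what
        \<open>unique_successor\<close> needs.\<close>
      have "E\<inverse> `` {v} = {x}"
        using that v by (metis card_1_singletonE Image_singleton_iff converse_iff singletonD)
      then have "E `` {v} = {y}"
        using assms v by (intro unique_successor[where H = H]) auto
      then show ?thesis
        using that by (simp add: lin_def)
    qed
    moreover have "lin v" if "card (E `` {v}) = 1"
    proof -
      have "E `` {v} = {y}"
        using that v by (metis card_1_singletonE Image_singleton_iff converse_iff singletonD)
      then have "E\<inverse> `` {v} = {x}"
        using assms v by (intro unique_predecessor[where H = H]) auto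
      then show ?thesis
        using that by (simp add: lin_def)
    qed
    moreover have "card (E `` {v}) \<noteq> 0" "card (E\<inverse> `` {v}) \<noteq> 0"
      using v finite_neighbours by auto
    \<comment> \<open>If one of the degrees is 1, then \<open>v\<close> is linear and the weight is
      2 + 2; otherwise both degrees are at least 2.\<close>
    ultimately have "deg v + 2 * of_bool (lin v) \<ge> 4"
      unfolding deg_def lin_def by (cases "card (E `` {v}) = 1"; cases "card (E\<inverse> `` {v}) = 1") simp_all
    then show ?thesis
      by (simp add: vs)
  next
    case False
    then have "length vs \<ge> 2"
      using \<open>vs \<noteq> []\<close> by (cases vs) (auto simp: Suc_le_eq)
    then have "2 * (length vs + 1) \<le> (\<Sum>v\<in>set vs. 3)"
      using \<open>distinct vs\<close> by (simp add: distinct_card)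
    also have "\<dots> \<le> (\<Sum>v\<in>set vs. deg v + 2 * of_bool (lin v))"
      using ge3 by (intro sum_mono) (fastforce simp: of_bool_def)
    finally show ?thesis .
  qed
qed

lemma sum_of_bool_lin:
  "finite A \<Longrightarrow> (\<Sum>v\<in>A. of_bool (lin v)) = card {v \<in> A. lin v}"
  by (simp add: Collect_conj_eq)

text \<open>Induction on the number of vertices outside \<open>H\<close>: the inequality for
  \<open>H\<close> enlarged by an ear yields the one for \<open>H\<close>.\<close>

lemma sum_deg_le:
  assumes "H \<subseteq> V" "H \<noteq> {}"
    and "\<And>a b. a \<in> H \<Longrightarrow> b \<in> H \<Longrightarrow> (a, b) \<in> (Restr E H)\<^sup>*"
  shows "sum deg H \<le> 2 * card (Restr E H) + 2 * card {v \<in> V - H. lin v}"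
  using assms
proof (induction "card (V - H)" arbitrary: H rule: less_induct)
  case less
  show ?case
  proof (cases "H = V")
    case True
    moreover have "Restr E V = E"
      using E_subset by blast
    ultimately show ?thesis
      by (simp add: sum_deg_V)
  next
    case False
    then obtain x vs y where ear: "x \<in> H" "y \<in> H" "vs \<noteq> []" "distinct vs" "set vs \<inter> H = {}"
      "successively (\<lambda>a b. (a, b) \<in> E) (x # vs @ [y])"
      using ear_exists less.prems by metis
    define A where "A = list_arcs (x # vs @ [y])"
    define F where "F = Restr E H \<union> A"
    define H' where "H' = H \<union> set vs"
    have "A \<subseteq> E"
      unfolding A_def using ear(6) by (rule list_arcs_subset)
    then have "F \<subseteq> E"
      by (auto simp: F_def)
    have "set vs \<subseteq> V"
    proof
      fix v
      assume "v \<in> set vs"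
      then have "(x, v) \<in> E\<^sup>*" "v \<noteq> x"
        using successively_rtrancl(1)[OF ear(6), of v] ear by auto
      then show "v \<in> V"
        using E_subset by (auto elim: rtranclE)
    qed
    have A_F: "A\<^sup>* \<subseteq> F\<^sup>*" and H_F: "(Restr E H)\<^sup>* \<subseteq> F\<^sup>*"
      by (auto simp: F_def intro!: rtrancl_mono)
    \<comment> \<open>Inside \<open>H\<close> this is strength of \<open>H\<close>; on the ear one
      walks along the ear. A walk from \<open>y\<close> back to \<open>x\<close> in \<open>H\<close>
      then makes \<open>F\<close> strong on \<open>H'\<close>.\<close>
    have from_x: "(x, a) \<in> F\<^sup>*" and to_y: "(a, y) \<in> F\<^sup>*" if "a \<in> H'" for a
    proof -
      have "(x, a) \<in> F\<^sup>* \<and> (a, y) \<in> F\<^sup>*"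
      proof (cases "a \<in> H")
        case True
        then show ?thesis
          using less.prems(3) ear H_F by blast
      next
        case False
        then have "a \<in> set (x # vs @ [y])"
          using that by (simp add: H'_def)
        from successively_rtrancl[OF successively_list_arcs this] show ?thesis
          using A_F by (auto simp: A_def)
      qed
      then show "(x, a) \<in> F\<^sup>*" "(a, y) \<in> F\<^sup>*"
        by auto
    qed
    have strong_F: "(a, b) \<in> F\<^sup>*" if "a \<in> H'" "b \<in> H'" for a b
    proof -
      have "(y, x) \<in> F\<^sup>*"
        using less.prems(3) ear H_F by blast
      then show ?thesis
        using from_x to_y that by (meson rtrancl_trans)
    qed
    have sub: "Restr E H' \<subseteq> F"
      using \<open>F \<subseteq> E\<close> strong_F by (rule Restr_subset_strong)
    \<comment> \<open>With this inclusion, strength of \<open>F\<close> becomes strength of the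
      subdigraph induced by \<open>H'\<close>, as the induction hypothesis requires.\<close>
    have "F \<subseteq> Restr E H'"
    proof -
      have "A \<subseteq> H' \<times> H'"
        using ear(1,2) unfolding A_def H'_def
        by (auto dest: set_zip_leftD set_zip_rightD)
      then show ?thesis
        using \<open>A \<subseteq> E\<close> by (auto simp: F_def H'_def)
    qed
    then have "Restr E H' = F"
      using sub by (rule subset_antisym[rotated])
    then have "sum deg H' \<le> 2 * card (Restr E H') + 2 * card {v \<in> V - H'. lin v}"
    proof (intro less.hyps)
      have "V - H' \<subset> V - H"
        using ear \<open>set vs \<subseteq> V\<close> by (cases vs) (auto simp: H'_def)
      then show "card (V - H') < card (V - H)"
        using finite_V by (intro psubset_card_mono) auto
    qed (use less.prems \<open>set vs \<subseteq> V\<close> strong_F in \<open>auto simp: H'_def\<close>)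
    moreover have "card (Restr E H') \<le> card (Restr E H) + (length vs + 1)"
    proof -
      have "card (Restr E H') \<le> card F"
        using sub \<open>F \<subseteq> E\<close> finite_E by (meson card_mono finite_subset)
      also have "\<dots> \<le> card (Restr E H) + card A"
        unfolding F_def by (rule card_Un_le)
      also have "card A \<le> length vs + 1"
        unfolding A_def using card_list_arcs[of "x # vs @ [y]"] by simp
      finally show ?thesis
        by simp
    qed
    moreover have "sum deg H' = sum deg H + sum deg (set vs)"
      unfolding H'_def using ear less.prems finite_V
      by (intro sum.union_disjoint) (auto intro: finite_subset)
    moreover have "sum deg (set vs) + 2 * card {v \<in> set vs. lin v} \<ge> 2 * (length vs + 1)"
    proof -
      have "set vs \<subseteq> V - H"
        using ear(5) \<open>set vs \<subseteq> V\<close> by blast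
      then have "(\<Sum>v\<in>set vs. deg v + 2 * of_bool (lin v)) \<ge> 2 * (length vs + 1)"
        using less.prems ear by (intro ear_weight) auto
      then show ?thesis
        by (simp only: sum.distrib sum_distrib_left[symmetric] sum_of_bool_lin finite_set)
    qed
    moreover have "card {v \<in> V - H. lin v} = card {v \<in> V - H'. lin v} + card {v \<in> set vs. lin v}"
    proof -
      have "{v \<in> V - H. lin v} = {v \<in> V - H'. lin v} \<union> {v \<in> set vs. lin v}"
        using ear \<open>set vs \<subseteq> V\<close> by (auto simp: H'_def)
      moreover have "{v \<in> V - H'. lin v} \<inter> {v \<in> set vs. lin v} = {}"
        by (auto simp: H'_def)
      ultimately show ?thesis
        using finite_V by (simp add: card_Un_disjoint)
    qed
    \<comment> \<open>Twice the number of new arcs is cancelled by the weight of the ear, whose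
      linear vertices join those counted outside \<open>H\<close>.\<close>
    ultimately show ?thesis
      by (simp add: algebra_simps)
  qed
qed

section \<open>The bound for a cycle\<close>

text \<open>The degree inequality is applied to the vertex set of the cycle. The list
  \<open>ws\<close> repeats its first vertex at the end, hence \<open>q + 1\<close> entries and
  distinctness of \<open>tl ws\<close> only.\<close>

lemma cycle_le_twice_card_lin:
  assumes "ws \<noteq> []" "hd ws = last ws" "distinct (tl ws)" "length ws = q + 1" "q \<ge> 2"
    and succ: "successively (\<lambda>a b. (a, b) \<in> E) ws"
  shows "q \<le> 2 * card {v \<in> V. lin v}"
proof -
  define A where "A = list_arcs ws"
  define H where "H = set ws"
  have "A \<subseteq> E"
    unfolding A_def using succ by (rule list_arcs_subset)
  \<comment> \<open>Walk from \<open>a\<close> to the end of the list, which is also its start, and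
    on to \<open>b\<close>.\<close>
  have strong_A: "(a, b) \<in> A\<^sup>*" if "a \<in> H" "b \<in> H" for a b
    using successively_rtrancl[OF successively_list_arcs] assms(2) that
    unfolding A_def H_def by (metis rtrancl_trans)
  obtain w ws' where ws: "ws = w # ws'" "ws' \<noteq> []"
    using assms(1,4,5) by (cases ws) force+
  then have "H = set ws'"
    using assms(2) by (auto simp: H_def)
  then have "card H = q"
    using assms(3,4) ws by (simp add: distinct_card)
  have sub: "Restr E H \<subseteq> A"
    using \<open>A \<subseteq> E\<close> strong_A by (rule Restr_subset_strong)
  have "A \<subseteq> H \<times> H"
    unfolding A_def H_def by (cases ws) (auto dest: set_zip_leftD set_zip_rightD)
  then have "Restr E H = A"
    using sub \<open>A \<subseteq> E\<close> by blast
  have "H \<subseteq> V"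
  proof
    fix v
    assume "v \<in> H"
    show "v \<in> V"
    proof (cases "v = w")
      case True
      then show ?thesis
        using succ E_subset ws by (cases ws') auto
    next
      case False
      have "(w, v) \<in> E\<^sup>*"
        using successively_rtrancl(1)[OF succ] \<open>v \<in> H\<close> ws by (auto simp: H_def)
      then show ?thesis
        using False E_subset by (auto elim: rtranclE)
    qed
  qed
  have nbrs: "E `` {v} \<noteq> {}" "E\<inverse> `` {v} \<noteq> {}" if "v \<in> H" for v
  proof -
    \<comment> \<open>Here \<open>q \<ge> 2\<close> supplies a second vertex on the cycle.\<close>
    have "H \<noteq> {v}"
      using \<open>card H = q\<close> assms(5) by auto
    then obtain u where "u \<in> H" "u \<noteq> v"
      using \<open>v \<in> H\<close> by blast
    then show "E `` {v} \<noteq> {}" "E\<inverse> `` {v} \<noteq> {}"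
      using neighbours_nonempty[of v u] that \<open>H \<subseteq> V\<close> by auto
  qed
  have "3 * q = (\<Sum>v\<in>H. 3)"
    using \<open>card H = q\<close> by simp
  also have "\<dots> \<le> (\<Sum>v\<in>H. deg v + of_bool (lin v))"
    using deg_plus_lin nbrs by (intro sum_mono) auto
  also have "\<dots> = sum deg H + card {v \<in> H. lin v}"
    by (simp only: sum.distrib sum_of_bool_lin H_def finite_set)
  also have "sum deg H \<le> 2 * card A + 2 * card {v \<in> V - H. lin v}"
    using sum_deg_le[OF \<open>H \<subseteq> V\<close>] strong_A \<open>Restr E H = A\<close> assms(1) by (simp add: H_def)
  also have "card A \<le> q"
    unfolding A_def using card_list_arcs[of ws] assms(4) by simp
  finally have "q \<le> 2 * card {v \<in> V - H. lin v} + card {v \<in> H. lin v}"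
    by simp
  moreover have "card {v \<in> V. lin v} = card {v \<in> V - H. lin v} + card {v \<in> H. lin v}"
  proof -
    have "{v \<in> V. lin v} = {v \<in> V - H. lin v} \<union> {v \<in> H. lin v}"
      using \<open>H \<subseteq> V\<close> by auto
    moreover have "{v \<in> V - H. lin v} \<inter> {v \<in> H. lin v} = {}"
      by auto
    ultimately show ?thesis
      using finite_V by (simp add: card_Un_disjoint H_def)
  qed
  \<comment> \<open>Linear vertices on the cycle enter the bound once, those off it twice.\<close>
  ultimately show ?thesis
    by linarith
qed

end

section \<open>Transfer to digraphs with arc objects\<close>

context minimal_strong_digraph
begin

text \<open>An arc whose ends form one of the remaining pairs cannot be \<open>e\<close>.\<close>

lemma awalk_avoiding_arc:
  assumes "(u, v) \<in> (arcs_ends G - {(tail G e, head G e)})\<^sup>*" "v \<in> verts G"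
  shows "\<exists>p. awalk u p v \<and> e \<notin> set p"
  using assms(1)
proof (induction rule: converse_rtrancl_induct)
  case base
  then show ?case
    using assms(2) by (intro exI[of _ "[]"]) (auto simp: awalk_Nil_iff)
next
  case (step u w)
  then obtain p where p: "awalk w p v" "e \<notin> set p"
    by blast
  obtain f where "f \<in> arcs G" "tail G f = u" "head G f = w"
    using step.hyps(1) by (auto simp: arcs_ends_conv)
  then show ?case
    using p step.hyps(1) by (intro exI[of _ "f # p"]) (auto simp: awalk_Cons_iff)
qed

lemma minimal_strong_relation_arcs_ends: "minimal_strong_relation (verts G) (arcs_ends G)"
proof
  show "arcs_ends G \<subseteq> verts G \<times> verts G"
    by (auto simp: arcs_ends_conv)
  show "(u, v) \<in> (arcs_ends G)\<^sup>*" if "u \<in> verts G" "v \<in> verts G" for u v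
    using strongly_connected that unfolding strongly_connected_def
    by (auto simp: reachable_conv)
  show "(u, v) \<notin> (arcs_ends G - {(u, v)})\<^sup>*" if uv: "(u, v) \<in> arcs_ends G" for u v
  proof
    assume "(u, v) \<in> (arcs_ends G - {(u, v)})\<^sup>*"
    moreover obtain e where e: "e \<in> arcs G" "tail G e = u" "head G e = v"
      using uv by (auto simp: arcs_ends_conv)
    ultimately obtain p where p: "awalk u p v" "e \<notin> set p"
      using awalk_avoiding_arc[of u v e] by auto
    \<comment> \<open>Shortening the walk to a path introduces no new arcs, so \<open>e\<close>
      would be transitive.\<close>
    then have "apath u (awalk_to_apath p) v" "e \<notin> set (awalk_to_apath p)"
      using apath_awalk_to_apath awalk_to_apath_subset by blast+
    then show False
      using no_transitive_arcs[of e] e by (auto simp: transitive_arc_def)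
  qed
qed simp

text \<open>As there are no parallel arcs, the arcs leaving \<open>v\<close> are determined by their
  heads.\<close>

lemma out_degree_eq_card: "out_degree G v = card (arcs_ends G `` {v})"
proof -
  have "inj_on (head G) (out_arcs G v)"
    by (rule inj_onI) (auto intro: no_multi_arcs simp: arc_to_ends_def)
  moreover have "head G ` out_arcs G v = arcs_ends G `` {v}"
    by (auto simp: arcs_ends_conv)
  ultimately show ?thesis
    unfolding out_degree_def using card_image by metis
qed

lemma in_degree_eq_card: "in_degree G v = card ((arcs_ends G)\<inverse> `` {v})"
proof -
  have "inj_on (tail G) (in_arcs G v)"
    by (rule inj_onI) (auto intro: no_multi_arcs simp: arc_to_ends_def)
  moreover have "tail G ` in_arcs G v = (arcs_ends G)\<inverse> `` {v}"
    by (auto simp: arcs_ends_conv)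
  ultimately show ?thesis
    unfolding in_degree_def using card_image by metis
qed

lemma awalk_successively:
  "awalk u p v \<Longrightarrow> successively (\<lambda>a b. (a, b) \<in> arcs_ends G) (awalk_verts u p)"
proof (induction p arbitrary: u)
  case (Cons e p)
  then have "awalk (head G e) p v" "e \<in> arcs G" "u = tail G e"
    by (auto simp: awalk_Cons_iff)
  moreover have "hd (awalk_verts (head G e) p) = head G e"
    using \<open>awalk (head G e) p v\<close> by simp
  ultimately show ?case
    using Cons.IH[of "head G e"] by (auto simp: successively_Cons arcs_ends_conv)
qed simp

end

theorem theorem4:
  fixes D :: "('a, 'b) pre_digraph" and C :: "'b awalk" and q :: nat
  assumes "minimal_strong_digraph D"
    and "pre_digraph.cycle D C" and "length C = q" and "q \<ge> 2"
  shows "card {v. pre_digraph.linear_vertex D v} \<ge> (q + 1) div 2"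
proof -
  interpret minimal_strong_digraph D
    by (rule assms(1))
  interpret rel: minimal_strong_relation "verts D" "arcs_ends D"
    by (rule minimal_strong_relation_arcs_ends)
  obtain u where u: "awalk u C u" "distinct (tl (awalk_verts u C))"
    using assms(2) unfolding cycle_def by blast
  have "q \<le> 2 * card {v \<in> verts D. rel.lin v}"
  proof (rule rel.cycle_le_twice_card_lin)
    show "hd (awalk_verts u C) = last (awalk_verts u C)"
      using u(1) by simp
    show "length (awalk_verts u C) = q + 1"
      using assms(3) by (simp add: length_awalk_verts)
  qed (use u assms awalk_successively in auto)
  moreover have "{v. linear_vertex v} = {v \<in> verts D. rel.lin v}"
    by (auto simp: linear_vertex_def rel.lin_def out_degree_eq_card in_degree_eq_card)
  \<comment> \<open>For \<open>q \<le> 2 * k\<close> one has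
    \<open>(q + 1) div 2 \<le> (2 * k + 1) div 2 = k\<close>.\<close>
  ultimately show ?thesis
    by simp
qed

end
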